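(* Let $\mathfrak g,\mathfrak h$ be Lie-Yamaguti algebras over a field $k$. Let $(\mathfrak g\oplus\mathfrak h,[\cdot,\cdot]_{\chi_0},\{\cdot,\cdot,\cdot\}_{\omega_0})$ and $(\mathfrak g\oplus\mathfrak h,[\cdot,\cdot]_{\chi},\{\cdot,\cdot,\cdot\}_{\omega})$ be two non-abelian extensions of $\mathfrak g$ by $\mathfrak h$, given by septuples $(\chi_0,\omega_0,\mu_0,\theta_0,D_0,\rho_0,T_0)$ and $(\chi,\omega,\mu,\theta,D,\rho,T)$ respectively. Then these two extensions are equivalent if and only if the associated Maurer-Cartan elements $\Pi_0=(\bar\chi_0,\bar\omega_0)$ and $\Pi=(\bar\chi,\bar\omega)$ are gauge equivalent.
   Context: **Lie-Yamaguti algebras.** A Lie-Yamaguti algebra over $k$ is a vector space $\mathfrak g$ with a bilinear map $[\cdot,\cdot]$ and a trilinear map $\{\cdot,\cdot,\cdot\}$ such that for all elements $[x_1,x_2]+[x_2,x_1]=0$, $\{x_1,x_2,x_3\}+\{x_2,x_1,x_3\}=0$; $[[x_1,x_2],x_3]+[[x_2,x_3],x_1]+[[x_3,x_1],x_2]+\{x_1,x_2,x_3\}+\{x_2,x_3,x_1\}+\{x_3,x_1,x_2\}=0$; $\{[x_1,x_2],x_3,y_1\}+\{[x_2,x_3],x_1,y_1\}+\{[x_3,x_1],x_2,y_1\}=0$; $\{x_1,x_2,[y_1,y_2]\}=[\{x_1,x_2,y_1\},y_2]+[y_1,\{x_1,x_2,y_2\}]$; $\{x_1,x_2,\{y_1,y_2,y_3\}\}=\{\{x_1,x_2,y_1\},y_2,y_3\}+\{y_1,\{x_1,x_2,y_2\},y_3\}+\{y_1,y_2,\{x_1,x_2,y_3\}\}$.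 Homomorphisms are linear maps preserving both operations. **The extensions.** A septuple consists of (multi)linear maps $\chi:\mathfrak g\otimes\mathfrak g\to\mathfrak h$, $\omega:\mathfrak g^{\otimes3}\to\mathfrak h$, $\mu:\mathfrak g\to\mathfrak{gl}(\mathfrak h)$, $\theta,D:\mathfrak g\otimes\mathfrak g\to\mathfrak{gl}(\mathfrak h)$, $\rho,T:\mathfrak g\to\mathrm{Hom}(\mathfrak h\otimes\mathfrak h,\mathfrak h)$. It defines on $\mathfrak g\oplus\mathfrak h$, for $x,y,z\in\mathfrak g$, $a,b,c\in\mathfrak h$, $$[x+a,y+b]_\chi=[x,y]_{\mathfrak g}+\chi(x,y)+\mu(x)b-\mu(y)a+[a,b]_{\mathfrak h},$$ $$\{x+a,y+b,z+c\}_\omega=\{x,y,z\}_{\mathfrak g}+\omega(x,y,z)+D(x,y)c+\theta(y,z)a-\theta(x,z)b+T(z)(a,b)+\rho(x)(b,c)-\rho(y)(a,c)+\{a,b,c\}_{\mathfrak h}.$$ That $(\mathfrak g\oplus\mathfrak h,[\cdot,\cdot]_\chi,\{\cdot,\cdot,\cdot\}_\omega)$ is a non-abelian extension of $\mathfrak g$ by $\mathfrak h$ means that it is a Lie-Yamaguti algebra, regarded as the extension $0\to\mathfrak h\to\mathfrak g\oplus\mathfrak h\to\mathfrak g\to0$ with the inclusion and the projection. Two such extensions are equivalent if there is a Lie-Yamaguti homomorphism between them which restricts to the identity on $\mathfrak h$ and commutes with the projections to $\mathfrak g$. **The elements $\Pi$.** Put $V=\mathfrak g\oplus\mathfrak h$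 and define $\bar\chi(x+a,y+b)=\chi(x,y)+\mu(x)b-\mu(y)a$, $\bar\omega(x+a,y+b,z+c)=\omega(x,y,z)+D(x,y)c+\theta(y,z)a-\theta(x,z)b+T(z)(a,b)+\rho(x)(b,c)-\rho(y)(a,c)$, and similarly $\bar\chi_0,\bar\omega_0$ from the other septuple. Then $\Pi=(\bar\chi,\bar\omega)$ and $\Pi_0=(\bar\chi_0,\bar\omega_0)$ are elements of $\mathcal C^1(V,V)=\mathrm{Hom}(\wedge^2V,V)\times\mathrm{Hom}(\wedge^2V\otimes V,V)$ (degree $1$). They are Maurer-Cartan elements of the differential graded Lie algebra controlling such extensions; being Maurer-Cartan there is the same as the brackets displayed above being a Lie-Yamaguti structure on $\mathfrak g\oplus\mathfrak h$. Gauge equivalence involves only the bracket with degree-$0$ elements, described next. **Bracket and gauge equivalence.** For $f\in\mathcal C^0(V,V)=\mathrm{Hom}(V,V)$ (degree $0$) and $P=(P_I,P_{II})\in\mathcal C^1(V,V)$, the bracket $[f,P]_{LY}=-[P,f]_{LY}=([f,P]_I,[f,P]_{II})\in\mathcal C^1(V,V)$ is $[f,P]_I(u,v)=f(P_I(u,v))-P_I(f(u),v)-P_I(u,f(v))$, $[f,P]_{II}(u,v,w)=f(P_{II}(u,v,w))-P_{II}(f(u),v,w)-P_{II}(u,f(v),w)-P_{II}(u,v,f(w))$. Let $\Pi_{\mathfrak g\oplus\mathfrak h}=(\chi_{\mathfrak g\oplus\mathfrak h},\omega_{\mathfrak g\oplus\mathfrak h})$ with $\chi_{\mathfrak g\oplus\mathfrak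 h}(x+a,y+b)=[x,y]_{\mathfrak g}+[a,b]_{\mathfrak h}$, $\omega_{\mathfrak g\oplus\mathfrak h}(x+a,y+b,z+c)=\{x,y,z\}_{\mathfrak g}+\{a,b,c\}_{\mathfrak h}$. A linear map $\varphi\in\mathrm{Hom}(\mathfrak g,\mathfrak h)$ is viewed in $\mathrm{Hom}(V,V)$ via $\varphi(x+a)=\varphi(x)$; such maps form the degree-$0$ part of the differential graded Lie algebra in which $\Pi,\Pi_0$ live. Put $d\varphi=[\Pi_{\mathfrak g\oplus\mathfrak h},\varphi]_{LY}$ and $ad_\varphi P=[\varphi,P]_{LY}$. The elements $\Pi_0$ and $\Pi$ are gauge equivalent if there is $\varphi\in\mathrm{Hom}(\mathfrak g,\mathfrak h)$ with $$\Pi=e^{ad_\varphi}\Pi_0-\frac{e^{ad_\varphi}-1}{ad_\varphi}\,d\varphi,$$ where $e^{ad_\varphi}=\sum_{n\ge0}\frac1{n!}ad_\varphi^n$ and $\frac{e^{ad_\varphi}-1}{ad_\varphi}=\sum_{n\ge0}\frac1{(n+1)!}ad_\varphi^n$ (finitely many terms are nonzero on the elements concerned).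
   Formalization: The field k is assumed to have characteristic different from 2 and 3, because the gauge equivalence formula uses the coefficients 1/2! and 1/3!, which do not exist in those characteristics. *)

theory Defs
  imports
    "HOL-Analysis.Product_Vector"
    "HOL-Library.Function_Algebras"
    "HOL-Library.Groups_Big_Fun"
begin

text \<open>
  Vector spaces over a field \<open>'k\<close> are types of class \<open>ab_group_add\<close> with an explicit scalar
  multiplication (locale \<open>vector_space\<close>).  The direct sum of \<open>'g\<close> and \<open>'h\<close> is the product type
  \<open>'g \<times> 'h\<close> with scalar multiplication \<open>module_prod.scale\<close>; the element written \<open>x + a\<close> in the
  literature is the pair \<open>(x, a)\<close>.
\<close>

definition bilinear_map ::
  "('k::field \<Rightarrow> 'a::ab_group_add \<Rightarrow> 'a) \<Rightarrow> ('k \<Rightarrow> 'b::ab_group_add \<Rightarrow> 'b) \<Rightarrow>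
   ('k \<Rightarrow> 'c::ab_group_add \<Rightarrow> 'c) \<Rightarrow> ('a \<Rightarrow> 'b \<Rightarrow> 'c) \<Rightarrow> bool" where
  "bilinear_map s1 s2 s3 f \<longleftrightarrow>
     (\<forall>x. Vector_Spaces.linear s2 s3 (\<lambda>y. f x y)) \<and>
     (\<forall>y. Vector_Spaces.linear s1 s3 (\<lambda>x. f x y))"

definition trilinear_map ::
  "('k::field \<Rightarrow> 'a::ab_group_add \<Rightarrow> 'a) \<Rightarrow> ('k \<Rightarrow> 'b::ab_group_add \<Rightarrow> 'b) \<Rightarrow>
   ('k \<Rightarrow> 'c::ab_group_add \<Rightarrow> 'c) \<Rightarrow> ('k \<Rightarrow> 'd::ab_group_add \<Rightarrow> 'd) \<Rightarrow>
   ('a \<Rightarrow> 'b \<Rightarrow> 'c \<Rightarrow> 'd) \<Rightarrow> bool" where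
  "trilinear_map s1 s2 s3 s4 f \<longleftrightarrow>
     (\<forall>y z. Vector_Spaces.linear s1 s4 (\<lambda>x. f x y z)) \<and>
     (\<forall>x z. Vector_Spaces.linear s2 s4 (\<lambda>y. f x y z)) \<and>
     (\<forall>x y. Vector_Spaces.linear s3 s4 (\<lambda>z. f x y z))"

locale lie_yamaguti_algebra = vector_space scale
  for scale :: "'k::field \<Rightarrow> 'a::ab_group_add \<Rightarrow> 'a" +
  fixes br :: "'a \<Rightarrow> 'a \<Rightarrow> 'a"
    and tr :: "'a \<Rightarrow> 'a \<Rightarrow> 'a \<Rightarrow> 'a"
  assumes br_bilinear: "bilinear_map scale scale scale br"
    and tr_trilinear: "trilinear_map scale scale scale scale tr"
    and br_skew: "br x1 x2 + br x2 x1 = 0"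
    and tr_skew: "tr x1 x2 x3 + tr x2 x1 x3 = 0"
    and cyclic_br_tr:
      "br (br x1 x2) x3 + br (br x2 x3) x1 + br (br x3 x1) x2
       + tr x1 x2 x3 + tr x2 x3 x1 + tr x3 x1 x2 = 0"
    and cyclic_tr_br:
      "tr (br x1 x2) x3 y1 + tr (br x2 x3) x1 y1 + tr (br x3 x1) x2 y1 = 0"
    and tr_derivation_br:
      "tr x1 x2 (br y1 y2) = br (tr x1 x2 y1) y2 + br y1 (tr x1 x2 y2)"
    and tr_derivation_tr:
      "tr x1 x2 (tr y1 y2 y3) =
         tr (tr x1 x2 y1) y2 y3 + tr y1 (tr x1 x2 y2) y3 + tr y1 y2 (tr x1 x2 y3)"

definition lie_yamaguti_hom ::
  "('k::field \<Rightarrow> 'a::ab_group_add \<Rightarrow> 'a) \<Rightarrow> ('a \<Rightarrow> 'a \<Rightarrow> 'a) \<Rightarrow> ('a \<Rightarrow> 'a \<Rightarrow> 'a \<Rightarrow> 'a) \<Rightarrow>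
   ('k \<Rightarrow> 'b::ab_group_add \<Rightarrow> 'b) \<Rightarrow> ('b \<Rightarrow> 'b \<Rightarrow> 'b) \<Rightarrow> ('b \<Rightarrow> 'b \<Rightarrow> 'b \<Rightarrow> 'b) \<Rightarrow>
   ('a \<Rightarrow> 'b) \<Rightarrow> bool" where
  "lie_yamaguti_hom s1 br1 tr1 s2 br2 tr2 F \<longleftrightarrow>
     Vector_Spaces.linear s1 s2 F \<and>
     (\<forall>x y. F (br1 x y) = br2 (F x) (F y)) \<and>
     (\<forall>x y z. F (tr1 x y z) = tr2 (F x) (F y) (F z))"


section \<open>Non-abelian extensions\<close>

record ('g, 'h) septuple =
  chi   :: "'g \<Rightarrow> 'g \<Rightarrow> 'h"
  omega :: "'g \<Rightarrow> 'g \<Rightarrow> 'g \<Rightarrow> 'h"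
  mu    :: "'g \<Rightarrow> 'h \<Rightarrow> 'h"
  theta :: "'g \<Rightarrow> 'g \<Rightarrow> 'h \<Rightarrow> 'h"
  dd    :: "'g \<Rightarrow> 'g \<Rightarrow> 'h \<Rightarrow> 'h"  \<comment> \<open>the map \<open>D\<close>\<close>
  rho   :: "'g \<Rightarrow> 'h \<Rightarrow> 'h \<Rightarrow> 'h"
  tt    :: "'g \<Rightarrow> 'h \<Rightarrow> 'h \<Rightarrow> 'h"  \<comment> \<open>the map \<open>T\<close>\<close>

definition septuple_multilinear ::
  "('k::field \<Rightarrow> 'g::ab_group_add \<Rightarrow> 'g) \<Rightarrow> ('k \<Rightarrow> 'h::ab_group_add \<Rightarrow> 'h) \<Rightarrow>
   ('g, 'h) septuple \<Rightarrow> bool" where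
  "septuple_multilinear sg sh S \<longleftrightarrow>
     bilinear_map sg sg sh (chi S) \<and>
     trilinear_map sg sg sg sh (omega S) \<and>
     bilinear_map sg sh sh (mu S) \<and>
     trilinear_map sg sg sh sh (theta S) \<and>
     trilinear_map sg sg sh sh (dd S) \<and>
     trilinear_map sg sh sh sh (rho S) \<and>
     trilinear_map sg sh sh sh (tt S)"

definition ext_br ::
  "('g \<Rightarrow> 'g \<Rightarrow> 'g) \<Rightarrow> ('h \<Rightarrow> 'h \<Rightarrow> 'h) \<Rightarrow> ('g, 'h::ab_group_add) septuple \<Rightarrow>
   'g \<times> 'h \<Rightarrow> 'g \<times> 'h \<Rightarrow> 'g \<times> 'h" where
  "ext_br brg brh S = (\<lambda>(x, a) (y, b).
     (brg x y, chi S x y + mu S x b - mu S y a + brh a b))"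

definition ext_tr ::
  "('g \<Rightarrow> 'g \<Rightarrow> 'g \<Rightarrow> 'g) \<Rightarrow> ('h \<Rightarrow> 'h \<Rightarrow> 'h \<Rightarrow> 'h) \<Rightarrow> ('g, 'h::ab_group_add) septuple \<Rightarrow>
   'g \<times> 'h \<Rightarrow> 'g \<times> 'h \<Rightarrow> 'g \<times> 'h \<Rightarrow> 'g \<times> 'h" where
  "ext_tr trg trh S = (\<lambda>(x, a) (y, b) (z, c).
     (trg x y z,
      omega S x y z + dd S x y c + theta S y z a - theta S x z b
      + tt S z a b + rho S x b c - rho S y a c + trh a b c))"

definition nonabelian_extension ::
  "('k::field \<Rightarrow> 'g::ab_group_add \<Rightarrow> 'g) \<Rightarrow> ('g \<Rightarrow> 'g \<Rightarrow> 'g) \<Rightarrow> ('g \<Rightarrow> 'g \<Rightarrow> 'g \<Rightarrow> 'g) \<Rightarrow>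
   ('k \<Rightarrow> 'h::ab_group_add \<Rightarrow> 'h) \<Rightarrow> ('h \<Rightarrow> 'h \<Rightarrow> 'h) \<Rightarrow> ('h \<Rightarrow> 'h \<Rightarrow> 'h \<Rightarrow> 'h) \<Rightarrow>
   ('g, 'h) septuple \<Rightarrow> bool" where
  "nonabelian_extension sg brg trg sh brh trh S \<longleftrightarrow>
     septuple_multilinear sg sh S \<and>
     lie_yamaguti_algebra (module_prod.scale sg sh) (ext_br brg brh S) (ext_tr trg trh S)"

definition extensions_equivalent ::
  "('k::field \<Rightarrow> 'g::ab_group_add \<Rightarrow> 'g) \<Rightarrow> ('g \<Rightarrow> 'g \<Rightarrow> 'g) \<Rightarrow> ('g \<Rightarrow> 'g \<Rightarrow> 'g \<Rightarrow> 'g) \<Rightarrow>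
   ('k \<Rightarrow> 'h::ab_group_add \<Rightarrow> 'h) \<Rightarrow> ('h \<Rightarrow> 'h \<Rightarrow> 'h) \<Rightarrow> ('h \<Rightarrow> 'h \<Rightarrow> 'h \<Rightarrow> 'h) \<Rightarrow>
   ('g, 'h) septuple \<Rightarrow> ('g, 'h) septuple \<Rightarrow> bool" where
  "extensions_equivalent sg brg trg sh brh trh S0 S \<longleftrightarrow>
     (\<exists>F. lie_yamaguti_hom
            (module_prod.scale sg sh) (ext_br brg brh S0) (ext_tr trg trh S0)
            (module_prod.scale sg sh) (ext_br brg brh S) (ext_tr trg trh S) F \<and>
          (\<forall>a. F (0, a) = (0, a)) \<and>
          (\<forall>u. fst (F u) = fst u))"


section \<open>Degree-one cochains and gauge equivalence\<close>

text \<open>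
  Cochains of degree one on \<open>'v\<close> are pairs of a binary and a ternary operation.  Their addition and
  subtraction are the componentwise and pointwise ones of \<open>Product_Plus\<close> and \<open>Function_Algebras\<close>.
\<close>

type_synonym 'v cochain1 = "('v \<Rightarrow> 'v \<Rightarrow> 'v) \<times> ('v \<Rightarrow> 'v \<Rightarrow> 'v \<Rightarrow> 'v)"

definition cochain1_scale :: "('k \<Rightarrow> 'v \<Rightarrow> 'v) \<Rightarrow> 'k \<Rightarrow> 'v cochain1 \<Rightarrow> 'v cochain1" where
  "cochain1_scale s c P = ((\<lambda>u v. s c (fst P u v)), (\<lambda>u v w. s c (snd P u v w)))"

text \<open>The bracket \<open>[f, P]\<close> of a cochain of degree zero with one of degree one, i.e. \<open>ad f P\<close>.\<close>

definition ad_LY :: "('v \<Rightarrow> 'v) \<Rightarrow> 'v::ab_group_add cochain1 \<Rightarrow> 'v cochain1" where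
  "ad_LY f P =
     ((\<lambda>u v. f (fst P u v) - fst P (f u) v - fst P u (f v)),
      (\<lambda>u v w. f (snd P u v w) - snd P (f u) v w - snd P u (f v) w - snd P u v (f w)))"

text \<open>
  \<open>Sum_any\<close> is the sum of a finitely supported family.  Since \<open>fact\<close> is only available in
  characteristic zero, factorials are mapped from \<open>nat\<close> into the field.
  For \<open>f = hom_lift \<phi>\<close> one has \<open>f \<circ> f = 0\<close>, so the fifth and higher iterates of \<open>ad_LY f\<close> vanish on
  multilinear cochains; the coefficients that matter make sense as soon as 2 and 3 are invertible.
\<close>

definition exp_ad ::
  "('k::field \<Rightarrow> 'v \<Rightarrow> 'v) \<Rightarrow> ('v \<Rightarrow> 'v) \<Rightarrow> 'v::ab_group_add cochain1 \<Rightarrow> 'v cochain1" where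
  "exp_ad s f P =
     Sum_any (\<lambda>n::nat. cochain1_scale s (1 / of_nat (fact n)) ((ad_LY f ^^ n) P))"

text \<open>The operator \<open>(exp (ad f) - 1) / ad f\<close>, as a power series in \<open>ad f\<close>.\<close>

definition exp_ad_quot ::
  "('k::field \<Rightarrow> 'v \<Rightarrow> 'v) \<Rightarrow> ('v \<Rightarrow> 'v) \<Rightarrow> 'v::ab_group_add cochain1 \<Rightarrow> 'v cochain1" where
  "exp_ad_quot s f P =
     Sum_any (\<lambda>n::nat. cochain1_scale s (1 / of_nat (fact (n + 1))) ((ad_LY f ^^ n) P))"

definition Pi_sum ::
  "('g \<Rightarrow> 'g \<Rightarrow> 'g) \<Rightarrow> ('g \<Rightarrow> 'g \<Rightarrow> 'g \<Rightarrow> 'g) \<Rightarrow>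
   ('h \<Rightarrow> 'h \<Rightarrow> 'h) \<Rightarrow> ('h \<Rightarrow> 'h \<Rightarrow> 'h \<Rightarrow> 'h) \<Rightarrow> ('g \<times> 'h) cochain1" where
  "Pi_sum brg trg brh trh =
     ((\<lambda>(x, a) (y, b). (brg x y, brh a b)),
      (\<lambda>(x, a) (y, b) (z, c). (trg x y z, trh a b c)))"

definition Pi_septuple ::
  "('g, 'h) septuple \<Rightarrow> ('g::zero \<times> 'h::ab_group_add) cochain1" where
  "Pi_septuple S =
     ((\<lambda>(x, a) (y, b). (0, chi S x y + mu S x b - mu S y a)),
      (\<lambda>(x, a) (y, b) (z, c).
         (0, omega S x y z + dd S x y c + theta S y z a - theta S x z b
             + tt S z a b + rho S x b c - rho S y a c)))"

definition hom_lift :: "('g \<Rightarrow> 'h) \<Rightarrow> 'g::zero \<times> 'h \<Rightarrow> 'g \<times> 'h" where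
  "hom_lift \<phi> = (\<lambda>(x, a). (0, \<phi> x))"

text \<open>\<open>d \<phi> = [Pi_sum, \<phi>] = - [\<phi>, Pi_sum]\<close>\<close>

definition d_LY ::
  "('g::ab_group_add \<Rightarrow> 'g \<Rightarrow> 'g) \<Rightarrow> ('g \<Rightarrow> 'g \<Rightarrow> 'g \<Rightarrow> 'g) \<Rightarrow>
   ('h::ab_group_add \<Rightarrow> 'h \<Rightarrow> 'h) \<Rightarrow> ('h \<Rightarrow> 'h \<Rightarrow> 'h \<Rightarrow> 'h) \<Rightarrow>
   ('g \<Rightarrow> 'h) \<Rightarrow> ('g \<times> 'h) cochain1" where
  "d_LY brg trg brh trh \<phi> = - ad_LY (hom_lift \<phi>) (Pi_sum brg trg brh trh)"

definition gauge_equivalent ::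
  "('k::field \<Rightarrow> 'g::ab_group_add \<Rightarrow> 'g) \<Rightarrow> ('g \<Rightarrow> 'g \<Rightarrow> 'g) \<Rightarrow> ('g \<Rightarrow> 'g \<Rightarrow> 'g \<Rightarrow> 'g) \<Rightarrow>
   ('k \<Rightarrow> 'h::ab_group_add \<Rightarrow> 'h) \<Rightarrow> ('h \<Rightarrow> 'h \<Rightarrow> 'h) \<Rightarrow> ('h \<Rightarrow> 'h \<Rightarrow> 'h \<Rightarrow> 'h) \<Rightarrow>
   ('g \<times> 'h) cochain1 \<Rightarrow> ('g \<times> 'h) cochain1 \<Rightarrow> bool" where
  "gauge_equivalent sg brg trg sh brh trh P0 P \<longleftrightarrow>
     (\<exists>\<phi>. Vector_Spaces.linear sg sh \<phi> \<and>
          P = exp_ad (module_prod.scale sg sh) (hom_lift \<phi>) P0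
              - exp_ad_quot (module_prod.scale sg sh) (hom_lift \<phi>) (d_LY brg trg brh trh \<phi>))"

end

theory Submission
  imports Defs
begin

text \<open>
  Write \<open>E\<^sub>S\<close> for the pair of brackets on \<open>V = \<gg> \<oplus> \<hh>\<close> defined by a septuple
  \<open>S\<close>, so that \<open>E\<^sub>S\<close> is the sum of \<open>Pi_septuple S\<close> and \<open>Pi_sum\<close>
  (\<open>Pi_septuple_add_Pi_sum\<close>).  Both sides of the equivalence say that \<open>1 + \<phi>\<close> carries
  \<open>E\<^sub>S\<^sub>0\<close> to \<open>E\<^sub>S\<close> for some linear \<open>\<phi> : \<gg> \<rightarrow> \<hh>\<close>.

  On the side of extensions, a linear map of \<open>V\<close> that restricts to the identity on \<open>\<hh>\<close> and
  commutes with the projection to \<open>\<gg>\<close> is of the form \<open>1 + \<phi>\<close>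
  (\<open>extension_map_eq_id_plus_hom_lift\<close>).

  On the side of gauge transformations, put \<open>f = hom_lift \<phi>\<close>.  Then \<open>f\<close> is linear with
  \<open>f \<circ> f = 0\<close>, and \<open>1 + f\<close> and \<open>1 - f\<close> are mutually inverse: they are \<open>exp f\<close> and
  \<open>exp (- f)\<close>.  The operator \<open>ad f\<close> is a sum of commuting operators of square zero, one for
  each argument and one for the value of a cochain.  Hence \<open>exp (ad f)\<close> is the product of their
  exponentials, which means that it conjugates a cochain by \<open>1 + f\<close>
  (\<open>exp_ad_eq_exp_conjugate\<close>).  Since \<open>d \<phi> = - ad f Pi_sum\<close>, the second term of the gauge
  action telescopes (\<open>exp_ad_quot_ad_LY\<close>):
  \<open>- ((exp (ad f) - 1) / ad f) (d \<phi>) = exp (ad f) Pi_sum - Pi_sum\<close>.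
  The equation of gauge equivalence therefore reads \<open>E\<^sub>S = exp (ad f) E\<^sub>S\<^sub>0\<close>, which says
  that \<open>1 + f\<close> is a homomorphism (\<open>eq_exp_conjugate_iff_hom\<close>).
\<close>


section \<open>Multiadditive cochains\<close>

text \<open>
  A cochain of degree one that is additive in each argument.  Compatibility with scalars is not
  required: the scalars in the exponential series act on values only.
\<close>

definition multiadditive :: "'v::ab_group_add cochain1 \<Rightarrow> bool" where
  "multiadditive P \<longleftrightarrow>
     (\<forall>v. additive (\<lambda>u. fst P u v)) \<and> (\<forall>u. additive (fst P u)) \<and>
     (\<forall>v w. additive (\<lambda>u. snd P u v w)) \<and> (\<forall>u w. additive (\<lambda>v. snd P u v w)) \<and>
     (\<forall>u v. additive (snd P u v))"

lemma multiadditive_add: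
  assumes "multiadditive P" and "multiadditive Q"
  shows "multiadditive (P + Q)"
  using assms by (simp add: multiadditive_def additive_def algebra_simps)

lemma multiadditive_minus:
  assumes "multiadditive P"
  shows "multiadditive (- P)"
  using assms by (simp add: multiadditive_def additive_def algebra_simps)

lemma additive_if_linear: "Vector_Spaces.linear s1 s2 f \<Longrightarrow> additive f"
  by (simp add: additive_def Vector_Spaces.linear_iff)

lemma (in lie_yamaguti_algebra) multiadditive_operations: "multiadditive (br, tr)"
proof -
  have "additive (\<lambda>u. br u v)" and "additive (br u)" for u v
    using br_bilinear by (simp_all add: bilinear_map_def additive_def Vector_Spaces.linear_iff)
  moreover have "additive (\<lambda>u. tr u v w)" and "additive (\<lambda>v. tr u v w)" and "additive (tr u v)"
    for u v w
    using tr_trilinear by (simp_all add: trilinear_map_def additive_def Vector_Spaces.linear_iff)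
  ultimately show ?thesis
    by (simp add: multiadditive_def)
qed

lemma multiadditive_simps:
  assumes "multiadditive P"
  shows "fst P (u - u') v = fst P u v - fst P u' v"
    and "fst P u (v - v') = fst P u v - fst P u v'"
    and "fst P 0 v = 0" and "fst P u 0 = 0"
    and "snd P (u - u') v w = snd P u v w - snd P u' v w"
    and "snd P u (v - v') w = snd P u v w - snd P u v' w"
    and "snd P u v (w - w') = snd P u v w - snd P u v w'"
    and "snd P 0 v w = 0" and "snd P u 0 w = 0" and "snd P u v 0 = 0"
proof -
  have l2: "additive (\<lambda>u. fst P u v)" and r2: "additive (fst P u)"
    and l3: "additive (\<lambda>u. snd P u v w)" and m3: "additive (\<lambda>v. snd P u v w)"
    and r3: "additive (snd P u v)" for u v w
    using assms by (auto simp: multiadditive_def)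
  note laws = additive.diff additive.zero
  show "fst P (u - u') v = fst P u v - fst P u' v"
    and "fst P u (v - v') = fst P u v - fst P u v'"
    and "fst P 0 v = 0" and "fst P u 0 = 0"
    and "snd P (u - u') v w = snd P u v w - snd P u' v w"
    and "snd P u (v - v') w = snd P u v w - snd P u v' w"
    and "snd P u v (w - w') = snd P u v w - snd P u v w'"
    and "snd P 0 v w = 0" and "snd P u 0 w = 0" and "snd P u v 0 = 0"
    by (fact laws[OF l2] laws[OF r2] laws[OF l3] laws[OF m3] laws[OF r3])+
qed


section \<open>The exponential of the adjoint action of a square-zero endomorphism\<close>

text \<open>
  Transport of a cochain along \<open>1 + f\<close>.  This is conjugation when \<open>f\<close> is additive of square zero,
  since \<open>1 - f\<close> is then the inverse of \<open>1 + f\<close>.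
\<close>

definition exp_conjugate :: "('v \<Rightarrow> 'v) \<Rightarrow> 'v::ab_group_add cochain1 \<Rightarrow> 'v cochain1" where
  "exp_conjugate f P =
     ((\<lambda>u v. let p = fst P (u - f u) (v - f v) in p + f p),
      (\<lambda>u v w. let p = snd P (u - f u) (v - f v) (w - f w) in p + f p))"

text \<open>
  The divided powers \<open>(ad f)\<^sup>n / n!\<close> for additive \<open>f\<close> of square zero, written out so that no
  division occurs.  As \<open>ad f\<close> is a sum of commuting operators of square zero (three on binary
  cochains, four on ternary ones), these are the elementary symmetric polynomials in them: every
  term inserts \<open>f\<close> in \<open>n\<close> different places, with a sign for each argument.
\<close>

fun ad_divided_power :: "('v \<Rightarrow> 'v) \<Rightarrow> nat \<Rightarrow> 'v::ab_group_add cochain1 \<Rightarrow> 'v cochain1" where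
  "ad_divided_power f 0 (p, q) = (p, q)"
| "ad_divided_power f (Suc 0) (p, q) =
     ((\<lambda>u v. f (p u v) - p (f u) v - p u (f v)),
      (\<lambda>u v w. f (q u v w) - q (f u) v w - q u (f v) w - q u v (f w)))"
| "ad_divided_power f (Suc (Suc 0)) (p, q) =
     ((\<lambda>u v. p (f u) (f v) - f (p (f u) v) - f (p u (f v))),
      (\<lambda>u v w. q (f u) (f v) w + q (f u) v (f w) + q u (f v) (f w)
               - f (q (f u) v w) - f (q u (f v) w) - f (q u v (f w))))"
| "ad_divided_power f (Suc (Suc (Suc 0))) (p, q) =
     ((\<lambda>u v. f (p (f u) (f v))),
      (\<lambda>u v w. f (q (f u) (f v) w) + f (q (f u) v (f w)) + f (q u (f v) (f w))
               - q (f u) (f v) (f w)))"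
| "ad_divided_power f (Suc (Suc (Suc (Suc 0)))) (p, q) =
     ((\<lambda>u v. 0), (\<lambda>u v w. - f (q (f u) (f v) (f w))))"
| "ad_divided_power f (Suc (Suc (Suc (Suc (Suc n))))) (p, q) = ((\<lambda>u v. 0), (\<lambda>u v w. 0))"

text \<open>A linear endomorphism \<open>f\<close> with \<open>f \<circ> f = 0\<close>; the main example is \<open>hom_lift \<phi>\<close>.\<close>

locale square_zero_endomorphism = vector_space scale
  for scale :: "'k::field \<Rightarrow> 'v::ab_group_add \<Rightarrow> 'v" +
  fixes f :: "'v \<Rightarrow> 'v"
  assumes linear_f: "Vector_Spaces.linear scale scale f"
    and square_zero: "f (f x) = 0"
begin

lemma f_simps:
  "f (x + y) = f x + f y" "f (x - y) = f x - f y" "f (- x) = - f x" "f 0 = 0"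
  "f (scale c x) = scale c (f x)" "f (f x) = 0"
proof -
  have "additive f"
    using linear_f by (rule additive_if_linear)
  then show "f (x + y) = f x + f y" "f (x - y) = f x - f y" "f (- x) = - f x" "f 0 = 0"
    by (rule additive.add additive.diff additive.minus additive.zero)+
  show "f (scale c x) = scale c (f x)"
    using linear_f unfolding Vector_Spaces.linear_iff by blast
qed (rule square_zero)

lemma ad_LY_cochain1_scale:
  "ad_LY f (cochain1_scale scale c P) = cochain1_scale scale c (ad_LY f P)"
  by (simp add: ad_LY_def cochain1_scale_def f_simps scale_right_diff_distrib)

lemma scale_of_nat_Suc: "scale (of_nat (Suc n)) x = scale (of_nat n) x + x"
  by (simp add: scale_left_distrib add.commute)

lemma ad_LY_ad_divided_power:
  assumes "multiadditive P"
  shows "ad_LY f (ad_divided_power f n P)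
         = cochain1_scale scale (of_nat (Suc n)) (ad_divided_power f (Suc n) P)"
proof -
  obtain p q where P: "P = (p, q)"
    by fastforce
  note simps = multiadditive_simps[OF assms, unfolded P, simplified]
  consider "n = 0" | "n = Suc 0" | "n = Suc (Suc 0)" | "n = Suc (Suc (Suc 0))"
    | "n = Suc (Suc (Suc (Suc 0)))" | m where "n = Suc (Suc (Suc (Suc (Suc m))))"
    by (metis not0_implies_Suc)
  then show ?thesis
    unfolding P
    by cases
      (simp_all only: ad_divided_power.simps cochain1_scale_def ad_LY_def
        fst_conv snd_conv scale_of_nat_Suc f_simps simps of_nat_0 scale_zero_left,
       simp_all add: algebra_simps)
qed

lemma ad_LY_funpow:
  assumes "multiadditive P"
  shows "(ad_LY f ^^ n) P = cochain1_scale scale (of_nat (fact n)) (ad_divided_power f n P)"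
proof (induction n)
  case 0
  show ?case
    by (cases P) (simp add: cochain1_scale_def)
next
  case (Suc n)
  have "(ad_LY f ^^ Suc n) P
        = cochain1_scale scale (of_nat (fact n)) (ad_LY f (ad_divided_power f n P))"
    using Suc by (simp add: ad_LY_cochain1_scale)
  also have "\<dots> = cochain1_scale scale (of_nat (fact (Suc n))) (ad_divided_power f (Suc n) P)"
    unfolding ad_LY_ad_divided_power[OF assms]
    by (simp add: cochain1_scale_def algebra_simps)
  finally show ?case .
qed

lemma cochain1_scale_0: "cochain1_scale scale c 0 = 0"
  by (simp add: cochain1_scale_def zero_prod_def zero_fun_def)

text \<open>
  Nilpotency holds in every characteristic; in positive characteristic it removes the terms of the
  exponential series whose factorials vanish in the field.
\<close>

lemma ad_LY_funpow_eq_0: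
  assumes "multiadditive P" and "5 \<le> n"
  shows "(ad_LY f ^^ n) P = 0"
proof -
  have "n = Suc (Suc (Suc (Suc (Suc (n - 5)))))"
    using assms(2) by simp
  then obtain m where "n = Suc (Suc (Suc (Suc (Suc m))))"
    by blast
  then have "ad_divided_power f n P = 0"
    by (cases P) (simp add: zero_prod_def zero_fun_def)
  then show ?thesis
    by (simp only: ad_LY_funpow[OF assms(1)] cochain1_scale_0)
qed

lemma exp_ad_eq_sum:
  assumes "multiadditive P"
  shows "exp_ad scale f P
         = (\<Sum>n<5. cochain1_scale scale (1 / of_nat (fact n)) ((ad_LY f ^^ n) P))"
  unfolding exp_ad_def
proof (rule Sum_any.expand_superset)
  show "{n. cochain1_scale scale (1 / of_nat (fact n)) ((ad_LY f ^^ n) P) \<noteq> 0} \<subseteq> {..<5}"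
  proof (rule subsetI, rule ccontr)
    fix n :: nat
    assume "n \<notin> {..<5}"
    then have "(ad_LY f ^^ n) P = 0"
      using ad_LY_funpow_eq_0[OF assms] by simp
    moreover assume "n \<in> {n. cochain1_scale scale (1 / of_nat (fact n)) ((ad_LY f ^^ n) P) \<noteq> 0}"
    ultimately show False
      by (simp add: cochain1_scale_0)
  qed
qed simp

text \<open>
  Expanding the conjugate in the arguments \<open>u - f u\<close>, \<open>v - f v\<close>, \<open>w - f w\<close> gives the sum of
  the divided powers of \<open>ad f\<close>.
\<close>

lemma exp_ad_eq_exp_conjugate:
  assumes "multiadditive P" and "(2::'k) \<noteq> 0" and "(3::'k) \<noteq> 0"
  shows "exp_ad scale f P = exp_conjugate f P"
proof -
  \<comment> \<open>The largest factorial that matters is \<open>4! = 24\<close>, whose prime factors are 2 and 3.\<close>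
  have fact_nonzero: "(of_nat (fact n) :: 'k) \<noteq> 0" if "n < 5" for n
  proof -
    have "(6::'k) = 2 * 3" and "(24::'k) = 2 * 2 * 2 * 3"
      by simp_all
    then have "(6::'k) \<noteq> 0" and "(24::'k) \<noteq> 0"
      using assms(2,3) by (metis mult_eq_0_iff)+
    moreover have "n \<in> {0, 1, 2, 3, 4}"
      using that by auto
    ultimately show ?thesis
      using assms(2) by (auto simp: fact_numeral)
  qed
  have "exp_ad scale f P = (\<Sum>n<5. ad_divided_power f n P)"
    unfolding exp_ad_eq_sum[OF assms(1)] ad_LY_funpow[OF assms(1)]
    by (rule sum.cong) (simp_all add: cochain1_scale_def fact_nonzero)
  also have "\<dots> = exp_conjugate f P"
  proof -
    obtain p q where P: "P = (p, q)"
      by fastforce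
    note simps = multiadditive_simps[OF assms(1), unfolded P, simplified]
    show ?thesis
      unfolding P
      by (simp add: numeral_nat lessThan_Suc exp_conjugate_def Let_def fun_eq_iff simps f_simps
          algebra_simps)
  qed
  finally show ?thesis .
qed

lemma exp_ad_quot_ad_LY:
  assumes "multiadditive P"
  shows "exp_ad_quot scale f (ad_LY f P) = exp_ad scale f P - P"
proof -
  let ?term = "\<lambda>n. cochain1_scale scale (1 / of_nat (fact n)) ((ad_LY f ^^ n) P)"
  have "exp_ad_quot scale f (ad_LY f P) = Sum_any (\<lambda>n. ?term (Suc n))"
    by (simp add: exp_ad_quot_def funpow_swap1)
  also have "\<dots> = (\<Sum>n<4. ?term (Suc n))"
  proof (rule Sum_any.expand_superset)
    show "{n. ?term (Suc n) \<noteq> 0} \<subseteq> {..<4}"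
    proof
      fix n
      assume "n \<in> {n. ?term (Suc n) \<noteq> 0}"
      then have "\<not> 5 \<le> Suc n"
        using ad_LY_funpow_eq_0[OF assms] cochain1_scale_0 by fastforce
      then show "n \<in> {..<4}"
        by simp
    qed
  qed simp
  also have "\<dots> = (\<Sum>n<5. ?term n) - ?term 0"
    using sum.lessThan_Suc_shift[of ?term 4] by simp
  also have "\<dots> = exp_ad scale f P - P"
    unfolding exp_ad_eq_sum[OF assms] by (cases P) (simp add: cochain1_scale_def)
  finally show ?thesis .
qed

lemma exp_conjugate_add: "exp_conjugate f (P + Q) = exp_conjugate f P + exp_conjugate f Q"
  by (simp add: exp_conjugate_def Let_def fun_eq_iff f_simps algebra_simps)

lemma exp_conjugate_minus: "exp_conjugate f (- P) = - exp_conjugate f P"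
  by (simp add: exp_conjugate_def Let_def fun_eq_iff f_simps algebra_simps)

lemma eq_exp_conjugate_iff_hom:
  "P = exp_conjugate f Q \<longleftrightarrow>
     lie_yamaguti_hom scale (fst Q) (snd Q) scale (fst P) (snd P) (\<lambda>x. x + f x)"
proof -
  have linear: "Vector_Spaces.linear scale scale (\<lambda>x. x + f x)"
    using linear_f by (simp add: Vector_Spaces.linear_iff algebra_simps)
  have inverse: "x + f x - f (x + f x) = x" "x - f x + f (x - f x) = x" for x
    by (simp_all add: f_simps)
  show ?thesis
  proof
    assume "P = exp_conjugate f Q"
    with linear show "lie_yamaguti_hom scale (fst Q) (snd Q) scale (fst P) (snd P) (\<lambda>x. x + f x)"
      by (simp add: lie_yamaguti_hom_def exp_conjugate_def Let_def inverse)
  next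
    assume hom: "lie_yamaguti_hom scale (fst Q) (snd Q) scale (fst P) (snd P) (\<lambda>x. x + f x)"
    show "P = exp_conjugate f Q"
    proof (rule prod_eqI)
      show "fst P = fst (exp_conjugate f Q)"
      proof (intro ext)
        fix u v
        have "fst P (u - f u + f (u - f u)) (v - f v + f (v - f v))
              = fst (exp_conjugate f Q) u v"
          using hom by (simp add: lie_yamaguti_hom_def exp_conjugate_def Let_def)
        then show "fst P u v = fst (exp_conjugate f Q) u v"
          by (simp only: inverse)
      qed
      show "snd P = snd (exp_conjugate f Q)"
      proof (intro ext)
        fix u v w
        have "snd P (u - f u + f (u - f u)) (v - f v + f (v - f v)) (w - f w + f (w - f w))
              = snd (exp_conjugate f Q) u v w"
          using hom by (simp add: lie_yamaguti_hom_def exp_conjugate_def Let_def)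
        then show "snd P u v w = snd (exp_conjugate f Q) u v w"
          by (simp only: inverse)
      qed
    qed
  qed
qed

end


section \<open>Equivalences of extensions and gauge transformations\<close>

lemma Pi_septuple_add_Pi_sum:
  fixes brg :: "'g::ab_group_add \<Rightarrow> 'g \<Rightarrow> 'g"
  shows "Pi_septuple S + Pi_sum brg trg brh trh = (ext_br brg brh S, ext_tr trg trh S)"
  by (simp add: Pi_septuple_def Pi_sum_def ext_br_def ext_tr_def fun_eq_iff)

lemma multiadditive_Pi_sum:
  assumes "multiadditive (brg, trg)" and "multiadditive (brh, trh)"
  shows "multiadditive (Pi_sum brg trg brh trh)"
  using assms by (simp add: multiadditive_def additive_def Pi_sum_def)

lemma square_zero_endomorphism_hom_lift:
  assumes "Vector_Spaces.linear sg sh \<phi>"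
  shows "square_zero_endomorphism (module_prod.scale sg sh) (hom_lift \<phi>)"
proof -
  interpret \<phi>: Vector_Spaces.linear sg sh \<phi>
    by (rule assms)
  interpret vector_space_prod sg sh
    by unfold_locales
  show ?thesis
  proof (intro square_zero_endomorphism.intro square_zero_endomorphism_axioms.intro)
    show "Vector_Spaces.linear scale scale (hom_lift \<phi>)"
      by (auto simp: Vector_Spaces.linear_iff p.vector_space_axioms hom_lift_def scale_prod
          \<phi>.add \<phi>.scale)
  qed (auto simp: hom_lift_def \<phi>.zero p.vector_space_axioms zero_prod_def)
qed

lemma gauge_equivalent_iff_hom:
  fixes sg :: "'k::field \<Rightarrow> 'g::ab_group_add \<Rightarrow> 'g"
    and sh :: "'k \<Rightarrow> 'h::ab_group_add \<Rightarrow> 'h"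
  assumes "(2::'k) \<noteq> 0" and "(3::'k) \<noteq> 0"
    and "lie_yamaguti_algebra sg brg trg"
    and "lie_yamaguti_algebra sh brh trh"
    and "nonabelian_extension sg brg trg sh brh trh S0"
  shows "gauge_equivalent sg brg trg sh brh trh (Pi_septuple S0) (Pi_septuple S) \<longleftrightarrow>
         (\<exists>\<phi>. Vector_Spaces.linear sg sh \<phi> \<and>
           lie_yamaguti_hom
             (module_prod.scale sg sh) (ext_br brg brh S0) (ext_tr trg trh S0)
             (module_prod.scale sg sh) (ext_br brg brh S) (ext_tr trg trh S)
             (\<lambda>u. u + hom_lift \<phi> u))"
proof -
  let ?s = "module_prod.scale sg sh"
  let ?Q = "Pi_sum brg trg brh trh"
  let ?E = "(ext_br brg brh S0, ext_tr trg trh S0)"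
  have ext0: "lie_yamaguti_algebra ?s (ext_br brg brh S0) (ext_tr trg trh S0)"
    using assms(5) by (simp add: nonabelian_extension_def)
  have Q: "multiadditive ?Q"
    using assms(3,4) by (intro multiadditive_Pi_sum lie_yamaguti_algebra.multiadditive_operations)
  \<comment> \<open>Multiadditivity of \<open>Pi_septuple S0\<close> is inherited from the brackets of the extension.\<close>
  have Pi0: "Pi_septuple S0 = ?E + (- ?Q)"
    using Pi_septuple_add_Pi_sum[of S0 brg trg brh trh] by (simp add: eq_diff_eq)
  have P0: "multiadditive (Pi_septuple S0)"
    unfolding Pi0
    using lie_yamaguti_algebra.multiadditive_operations[OF ext0] multiadditive_minus[OF Q]
    by (rule multiadditive_add)
  have "Pi_septuple S = exp_ad ?s (hom_lift \<phi>) (Pi_septuple S0)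
                        - exp_ad_quot ?s (hom_lift \<phi>) (d_LY brg trg brh trh \<phi>)
        \<longleftrightarrow> lie_yamaguti_hom ?s (ext_br brg brh S0) (ext_tr trg trh S0)
              ?s (ext_br brg brh S) (ext_tr trg trh S) (\<lambda>u. u + hom_lift \<phi> u)"
    if \<phi>: "Vector_Spaces.linear sg sh \<phi>" for \<phi>
  proof -
    interpret square_zero_endomorphism ?s "hom_lift \<phi>"
      using \<phi> by (rule square_zero_endomorphism_hom_lift)
    \<comment> \<open>The sign in \<open>d \<phi> = - [\<phi>, Pi_sum]\<close> is moved inside, where the telescoping applies.\<close>
    have d: "d_LY brg trg brh trh \<phi> = ad_LY (hom_lift \<phi>) (- ?Q)"
      by (simp add: d_LY_def ad_LY_def fun_eq_iff f_simps)
    have "exp_ad ?s (hom_lift \<phi>) (Pi_septuple S0)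
            - exp_ad_quot ?s (hom_lift \<phi>) (d_LY brg trg brh trh \<phi>)
          = exp_conjugate (hom_lift \<phi>) (Pi_septuple S0 + ?Q) - ?Q"
      unfolding d exp_ad_quot_ad_LY[OF multiadditive_minus[OF Q]]
      using exp_ad_eq_exp_conjugate[OF P0 assms(1,2)]
        exp_ad_eq_exp_conjugate[OF multiadditive_minus[OF Q] assms(1,2)]
      by (simp add: exp_conjugate_add exp_conjugate_minus)
    then have "Pi_septuple S = exp_ad ?s (hom_lift \<phi>) (Pi_septuple S0)
                        - exp_ad_quot ?s (hom_lift \<phi>) (d_LY brg trg brh trh \<phi>)
        \<longleftrightarrow> Pi_septuple S + ?Q = exp_conjugate (hom_lift \<phi>) (Pi_septuple S0 + ?Q)"
      by (metis eq_diff_eq)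
    then show ?thesis
      unfolding Pi_septuple_add_Pi_sum eq_exp_conjugate_iff_hom by simp
  qed
  then show ?thesis
    unfolding gauge_equivalent_def by blast
qed

lemma extension_map_eq_id_plus_hom_lift:
  assumes "vector_space sg" and "vector_space sh"
    and F: "Vector_Spaces.linear (module_prod.scale sg sh) (module_prod.scale sg sh) F"
    and restrict: "\<And>a. F (0, a) = (0, a)"
    and project: "\<And>u. fst (F u) = fst u"
  obtains \<phi> where "Vector_Spaces.linear sg sh \<phi>" and "F = (\<lambda>u. u + hom_lift \<phi> u)"
proof -
  interpret vector_space_prod sg sh
    using assms(1,2) by (simp add: vector_space_prod_def vector_space_pair_def)
  \<comment> \<open>\<open>\<phi>\<close> measures how far \<open>F\<close> moves the section \<open>x \<mapsto> (x, 0)\<close>.\<close>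
  define \<phi> where "\<phi> x = snd (F (x, 0))" for x
  have F_x0: "F (x, 0) = (x, \<phi> x)" for x
    using project[of "(x, 0)"] by (simp add: \<phi>_def prod_eq_iff)
  have add: "F (u + v) = F u + F v" and scl: "F (scale c u) = scale c (F u)" for u v c
    using F unfolding Vector_Spaces.linear_iff by blast+
  have "Vector_Spaces.linear sg sh \<phi>"
  proof (unfold Vector_Spaces.linear_iff, intro conjI allI assms(1,2))
    show "\<phi> (x + y) = \<phi> x + \<phi> y" for x y
      using add[of "(x, 0)" "(y, 0)"] by (simp add: F_x0)
    show "\<phi> (sg c x) = sh c (\<phi> x)" for c x
      using scl[of c "(x, 0)"] by (simp add: F_x0 scale_prod)
  qed
  moreover have "F = (\<lambda>u. u + hom_lift \<phi> u)"
  proof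
    fix u
    show "F u = u + hom_lift \<phi> u"
      using add[of "(fst u, 0)" "(0, snd u)"]
      by (cases u) (simp add: F_x0 restrict hom_lift_def add.commute)
  qed
  ultimately show thesis
    by (rule that)
qed

theorem proposition4p6:
  fixes sg :: "'k::field \<Rightarrow> 'g::ab_group_add \<Rightarrow> 'g"
    and sh :: "'k \<Rightarrow> 'h::ab_group_add \<Rightarrow> 'h"
    and brg :: "'g \<Rightarrow> 'g \<Rightarrow> 'g" and trg :: "'g \<Rightarrow> 'g \<Rightarrow> 'g \<Rightarrow> 'g"
    and brh :: "'h \<Rightarrow> 'h \<Rightarrow> 'h" and trh :: "'h \<Rightarrow> 'h \<Rightarrow> 'h \<Rightarrow> 'h"
    and S0 S :: "('g, 'h) septuple"
  assumes "(2::'k) \<noteq> 0" and "(3::'k) \<noteq> 0"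
    and "lie_yamaguti_algebra sg brg trg"
    and "lie_yamaguti_algebra sh brh trh"
    and "nonabelian_extension sg brg trg sh brh trh S0"
    and "nonabelian_extension sg brg trg sh brh trh S"
  shows "extensions_equivalent sg brg trg sh brh trh S0 S \<longleftrightarrow>
         gauge_equivalent sg brg trg sh brh trh (Pi_septuple S0) (Pi_septuple S)"
  unfolding gauge_equivalent_iff_hom[OF assms(1-5)]
proof
  assume "extensions_equivalent sg brg trg sh brh trh S0 S"
  then obtain F where
    hom: "lie_yamaguti_hom
            (module_prod.scale sg sh) (ext_br brg brh S0) (ext_tr trg trh S0)
            (module_prod.scale sg sh) (ext_br brg brh S) (ext_tr trg trh S) F"
    and "\<And>a. F (0, a) = (0, a)" and "\<And>u. fst (F u) = fst u"
    unfolding extensions_equivalent_def by blast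
  moreover have "vector_space sg" and "vector_space sh"
    using assms(3,4) by (simp_all add: lie_yamaguti_algebra_def)
  ultimately obtain \<phi> where "Vector_Spaces.linear sg sh \<phi>" and "F = (\<lambda>u. u + hom_lift \<phi> u)"
    using extension_map_eq_id_plus_hom_lift[of sg sh F]
    unfolding lie_yamaguti_hom_def by blast
  with hom show "\<exists>\<phi>. Vector_Spaces.linear sg sh \<phi> \<and>
      lie_yamaguti_hom
        (module_prod.scale sg sh) (ext_br brg brh S0) (ext_tr trg trh S0)
        (module_prod.scale sg sh) (ext_br brg brh S) (ext_tr trg trh S) (\<lambda>u. u + hom_lift \<phi> u)"
    by blast
next
  assume "\<exists>\<phi>. Vector_Spaces.linear sg sh \<phi> \<and>
      lie_yamaguti_hom
        (module_prod.scale sg sh) (ext_br brg brh S0) (ext_tr trg trh S0)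
        (module_prod.scale sg sh) (ext_br brg brh S) (ext_tr trg trh S) (\<lambda>u. u + hom_lift \<phi> u)"
  then obtain \<phi> where linear: "Vector_Spaces.linear sg sh \<phi>"
    and hom: "lie_yamaguti_hom
        (module_prod.scale sg sh) (ext_br brg brh S0) (ext_tr trg trh S0)
        (module_prod.scale sg sh) (ext_br brg brh S) (ext_tr trg trh S) (\<lambda>u. u + hom_lift \<phi> u)"
    by blast
  have "\<phi> 0 = 0"
    using linear by (rule additive.zero[OF additive_if_linear])
  then have "(0, a) + hom_lift \<phi> (0, a) = (0, a)" for a
    by (simp add: hom_lift_def)
  moreover have "fst (u + hom_lift \<phi> u) = fst u" for u
    by (cases u) (simp add: hom_lift_def)
  ultimately show "extensions_equivalent sg brg trg sh brh trh S0 S"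
    using hom unfolding extensions_equivalent_def by blast
qed

end
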